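(* The set of pairs $(\alpha,\beta)\in\mathbb{R}^2$ satisfying $$\liminf_{q\to+\infty}\, q\,(\log q)^2\,\|q\alpha\|\,\|q\beta\|>0$$ (where $q$ runs over positive integers) has Hausdorff dimension $2$.
   Context: For a real number $x$, $\|x\|$ denotes the distance from $x$ to the nearest integer. *)

theory Defs
  imports "HOL-Analysis.Analysis"
begin

definition nint_dist :: "real \<Rightarrow> real" where
  "nint_dist x = infdist x \<int>"

text \<open>delta-approximating s-dimensional Hausdorff content, via countable covers by
  bounded sets of diameter at most delta (finite covers are included by padding with
  empty sets).\<close>
definition hausdorff_content :: "real \<Rightarrow> real \<Rightarrow> 'a::metric_space set \<Rightarrow> ennreal" where
  "hausdorff_content s \<delta> E =
     (INF U \<in> {U :: nat \<Rightarrow> 'a set. (\<forall>i. bounded (U i) \<and> diameter (U i) \<le> \<delta>) \<and> E \<subseteq> (\<Union>i. U i)}.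
        (\<Sum>i. ennreal (diameter (U i) powr s)))"

definition hausdorff_measure :: "real \<Rightarrow> 'a::metric_space set \<Rightarrow> ennreal" where
  "hausdorff_measure s E = (SUP \<delta> \<in> {0<..}. hausdorff_content s \<delta> E)"

definition hausdorff_dim :: "'a::metric_space set \<Rightarrow> real" where
  "hausdorff_dim E = Inf {s. 0 \<le> s \<and> hausdorff_measure s E = 0}"

end

theory Submission
  imports Defs
begin

text \<open>
  This is a Peres--Schlag argument carried out with dyadic squares. The pairs \<open>(\<alpha>, \<beta>)\<close> that are bad
  for some \<open>q\<close> in the range \<open>4^n \<le> log2 q < 4^(n+1)\<close> fill only a small constant
  proportion of every square of side at least \<open>1 / q\<close>: one logarithm is spent on the area of a
  hyperbolic region and one on the sum of \<open>1 / q\<close>. Hence at least half of the area survives every stage,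
  so the survivors of the \<open>n\<close>-th stage have area at least \<open>2^(-n)\<close>, whereas their scale decreases doubly
  exponentially. This leaves room to remove, in addition, the sets \<open>U i\<close> of a cover with
  \<open>\<Sum>i. diameter (U i) powr t\<close> small and \<open>t < 2\<close>, each one at the stage of its own scale: the total area
  removed in this way is at most a power of the scale. The point that remains in the
  end satisfies the Diophantine condition and lies outside the cover.
\<close>

section \<open>Counting cells\<close>

text \<open>The cells are closed, so that finite unions of squares are compact and a limit point
  exists. Natural indices suffice because the construction stays in the unit square.\<close>

definition cell :: "real \<Rightarrow> nat \<Rightarrow> real set" where
  "cell h i = {real i * h .. (real i + 1) * h}"

lemma card_le_sum_cover:
  assumes "N \<subseteq> (\<Union>i\<in>I. A i)" "finite I" "\<And>i. i \<in> I \<Longrightarrow> finite (A i)"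
  shows "real (card N) \<le> (\<Sum>i\<in>I. real (card (A i)))"
proof -
  have "card N \<le> card (\<Union>i\<in>I. A i)" using assms by (intro card_mono) auto
  also have "\<dots> \<le> (\<Sum>i\<in>I. card (A i))" by (rule card_UN_le[OF assms(2)])
  finally have "real (card N) \<le> real (\<Sum>i\<in>I. card (A i))" by (rule of_nat_mono)
  then show ?thesis by (simp only: of_nat_sum)
qed

lemma int_interval_card:
  fixes x y :: real
  assumes "x \<le> y"
  shows "finite {p::int. x \<le> of_int p \<and> of_int p \<le> y}"
    and "real (card {p::int. x \<le> of_int p \<and> of_int p \<le> y}) \<le> y - x + 1"
proof -
  have eq: "{p::int. x \<le> of_int p \<and> of_int p \<le> y} = {\<lceil>x\<rceil>..\<lfloor>y\<rfloor>}"
    by (auto simp: ceiling_le_iff le_floor_iff)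
  show "finite {p::int. x \<le> of_int p \<and> of_int p \<le> y}" unfolding eq by simp
  show "real (card {p::int. x \<le> of_int p \<and> of_int p \<le> y}) \<le> y - x + 1"
    unfolding eq using assms by (simp add: of_nat_nat) linarith
qed

text \<open>The index of such a cell is an integer in the interval from \<open>x / h - 1\<close> to
  \<open>y / h\<close>, whose length is \<open>(y - x) / h + 1\<close>.\<close>

lemma cells_meet_interval:
  fixes h x y :: real
  assumes "h > 0" "x \<le> y"
  shows "finite {i. cell h i \<inter> {x..y} \<noteq> {}}"
    and "real (card {i. cell h i \<inter> {x..y} \<noteq> {}}) \<le> (y - x) / h + 2"
proof -
  let ?I = "{i. cell h i \<inter> {x..y} \<noteq> {}}"
  let ?P = "{p::int. x / h - 1 \<le> of_int p \<and> of_int p \<le> y / h}"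
  have sub: "int ` ?I \<subseteq> ?P"
  proof
    fix p assume "p \<in> int ` ?I"
    then obtain i where p: "p = int i" and "i \<in> ?I" by blast
    then obtain z where z: "z \<in> cell h i" "x \<le> z" "z \<le> y" by auto
    have "x \<le> (real i + 1) * h" "real i * h \<le> y" using z by (auto simp: cell_def)
    then show "p \<in> ?P" using assms p by (simp add: field_simps)
  qed
  have le: "x / h - 1 \<le> y / h" using assms divide_right_mono[of x y h] by simp
  note P = int_interval_card[OF le]
  have "finite (int ` ?I)" using sub P(1) finite_subset by blast
  then show "finite ?I" by (simp add: finite_image_iff)
  have "card ?I = card (int ` ?I)" by (simp add: card_image)
  also have "\<dots> \<le> card ?P" using sub P(1) card_mono by blast
  finally have "real (card ?I) \<le> real (card ?P)" by simp
  also have "\<dots> \<le> (y - x) / h + 2" using P(2) by (simp add: diff_divide_distrib)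
  finally show "real (card ?I) \<le> (y - x) / h + 2" .
qed

lemma div_fibre:
  fixes M u :: nat
  assumes "M > 0"
  shows "{i. i div M = u} = {u * M..<u * M + M}"
proof -
  have "i div M = u \<longleftrightarrow> u * M \<le> i \<and> i < u * M + M" for i
  proof
    assume "i div M = u"
    then show "u * M \<le> i \<and> i < u * M + M"
      using div_times_less_eq_dividend[of i M] dividend_less_div_times[OF assms, of i]
      by (simp add: add.commute)
  next
    assume "u * M \<le> i \<and> i < u * M + M"
    then show "i div M = u" by (intro div_nat_eqI) (simp_all add: mult.commute)
  qed
  then show ?thesis by (intro set_eqI) (simp only: mem_Collect_eq atLeastLessThan_iff)
qed

lemma cell_subset_div:
  assumes "h \<ge> 0" "M > 0"
  shows "cell h i \<subseteq> cell (real M * h) (i div M)"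
proof -
  have "i \<in> {(i div M) * M..<(i div M) * M + M}" using div_fibre[OF assms(2)] by blast
  then have *: "(i div M) * M \<le> i" "i + 1 \<le> ((i div M) + 1) * M" by auto
  from *(1) have 1: "real (i div M) * real M \<le> real i" by (metis of_nat_le_iff of_nat_mult)
  from *(2) have 2: "real i + 1 \<le> (real (i div M) + 1) * real M"
    by (metis of_nat_1 of_nat_add of_nat_le_iff of_nat_mult)
  from mult_right_mono[OF 1 assms(1)] mult_right_mono[OF 2 assms(1)] show ?thesis
    by (auto simp: cell_def mult.assoc)
qed

section \<open>Distance to the nearest integer and strips around rationals\<close>

lemma nint_dist_attained: "\<exists>p::int. nint_dist x = \<bar>x - of_int p\<bar>"
proof -
  have "closed (\<int>::real set)" by simp
  moreover have "(\<int>::real set) \<noteq> {}" using Ints_0 by blast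
  ultimately obtain z where "z \<in> \<int>" "infdist x \<int> = dist x z"
    using infdist_attains_inf by metis
  then show ?thesis by (auto simp: nint_dist_def dist_real_def elim!: Ints_cases)
qed

lemma nint_dist_nonneg: "nint_dist x \<ge> 0"
  by (simp add: nint_dist_def infdist_nonneg)

lemma nint_dist_le_1: "nint_dist x \<le> 1"
proof -
  have "nint_dist x \<le> dist x (of_int \<lfloor>x\<rfloor>)"
    unfolding nint_dist_def by (rule infdist_le) simp
  also have "\<dots> \<le> 1" by (simp add: dist_real_def) linarith
  finally show ?thesis .
qed

text \<open>The condition confines \<open>x\<close> to strips of width \<open>2 * a / q\<close>
  around the points \<open>p / q\<close>. For \<open>a\<close> at most 1/2 the coarse cell, of
  length at least \<open>1 / q\<close>, meets at most \<open>3 * (q * h * M)\<close> strips, and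
  each strip meets at most \<open>4 * a / (q * h)\<close> fine cells. For larger \<open>a\<close>
  the bound exceeds the number \<open>M\<close> of all fine cells.\<close>

lemma near_rational_cells_card:
  fixes M q u :: nat and a h :: real
  assumes h: "h > 0" and M: "M > 0" and q: "q > 0" and qh: "q * h \<le> a" and qhM: "1 \<le> q * h * M"
  shows "real (card {i. i div M = u \<and> (\<exists>x\<in>cell h i. nint_dist (q * x) \<le> a)}) \<le> 12 * a * M"
    (is "real (card ?N) \<le> _")
proof -
  have a: "a > 0" using qh h q by (meson less_le_trans mult_pos_pos of_nat_0_less_iff)
  have "card ?N \<le> card {i. i div M = u}"
    by (rule card_mono) (simp add: div_fibre[OF M], blast)
  then have NM: "card ?N \<le> M" by (simp add: div_fibre[OF M])
  show ?thesis
  proof (cases "a > 1 / 2")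
    case True
    then have "1 * real M \<le> 12 * a * M" by (intro mult_right_mono) auto
    with NM show ?thesis by linarith
  next
    case False
    \<comment> \<open>For \<open>z\<close> in the coarse cell \<open>u\<close>, the number
      \<open>q * z\<close> lies between \<open>x + a\<close> and \<open>y - a\<close>, so an integer
      within \<open>a\<close> of it belongs to \<open>P\<close>.\<close>
    define x where "x = real q * (real u * (M * h)) - a"
    define y where "y = real q * ((real u + 1) * (M * h)) + a"
    define P where "P = {p::int. x \<le> of_int p \<and> of_int p \<le> y}"
    define I where "I p = {i. cell h i \<inter> {(of_int p - a) / q .. (of_int p + a) / q} \<noteq> {}}" for p :: int
    have yx: "y - x = q * h * M + 2 * a" by (simp add: x_def y_def algebra_simps)
    then have xy: "x \<le> y" using a qhM by linarith
    have P: "finite P" "real (card P) \<le> 3 * (q * h * M)"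
      using int_interval_card[OF xy] yx False qhM unfolding P_def by linarith+
    have le: "(of_int p - a) / q \<le> (of_int p + a) / q" for p :: int
      using a by (intro divide_right_mono) auto
    have I: "finite (I p)" "real (card (I p)) \<le> 4 * a / (q * h)" for p
    proof -
      show "finite (I p)" unfolding I_def by (rule cells_meet_interval(1)[OF h le])
      have "real (card (I p)) \<le> ((of_int p + a) / q - (of_int p - a) / q) / h + 2"
        unfolding I_def by (rule cells_meet_interval(2)[OF h le])
      also have "\<dots> = 2 * a / (q * h) + 2" using h q by (simp add: field_simps)
      also have "\<dots> \<le> 2 * a / (q * h) + 2 * (a / (q * h))" using qh h q by (simp add: field_simps)
      also have "\<dots> = 4 * a / (q * h)" by simp
      finally show "real (card (I p)) \<le> 4 * a / (q * h)" .
    qed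
    have "?N \<subseteq> (\<Union>p\<in>P. I p)"
    proof
      fix i assume "i \<in> ?N"
      then obtain z :: real where iu: "i div M = u" and z: "z \<in> cell h i" and nz: "nint_dist (q * z) \<le> a"
        by auto
      obtain p :: int where p: "\<bar>q * z - of_int p\<bar> \<le> a" using nint_dist_attained nz by metis
      have "z \<in> cell (M * h) u" using cell_subset_div[of h M i] z iu h M by auto
      then have "q * (real u * (M * h)) \<le> q * z" "q * z \<le> q * ((real u + 1) * (M * h))"
        by (auto simp: cell_def intro!: mult_left_mono)
      then have "p \<in> P" using p unfolding P_def x_def y_def by auto
      moreover have "z \<in> {(of_int p - a) / q .. (of_int p + a) / q}"
        using p q by (auto simp: field_simps abs_le_iff)
      ultimately show "i \<in> (\<Union>p\<in>P. I p)" using z unfolding I_def by blast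
    qed
      then have "real (card ?N) \<le> (\<Sum>p\<in>P. real (card (I p)))"
    by (rule card_le_sum_cover) (use P(1) I(1) in auto)
    also have "\<dots> \<le> (\<Sum>p\<in>P. 4 * a / (q * h))" by (intro sum_mono I(2))
    also have "\<dots> = card P * (4 * a / (q * h))" by simp
    also have "\<dots> \<le> 3 * (q * h * M) * (4 * a / (q * h))"
      using P(2) a h q by (intro mult_right_mono) auto
    also have "\<dots> = 12 * a * M" using h q by (simp add: field_simps)
    finally show ?thesis .
  qed
qed

section \<open>Squares of a grid and their ancestors in a coarser grid\<close>

definition square :: "real \<Rightarrow> nat \<times> nat \<Rightarrow> (real \<times> real) set" where
  "square h c = cell h (fst c) \<times> cell h (snd c)"

definition ancestor :: "nat \<Rightarrow> nat \<times> nat \<Rightarrow> nat \<times> nat" where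
  "ancestor M c = (fst c div M, snd c div M)"

lemma ancestor_ancestor: "ancestor M (ancestor M' c) = ancestor (M' * M) c"
  by (simp add: ancestor_def div_mult2_eq)

lemma square_subset_ancestor:
  assumes "h \<ge> 0" "M > 0"
  shows "square h c \<subseteq> square (real M * h) (ancestor M c)"
  using cell_subset_div[OF assms] unfolding square_def ancestor_def by (simp add: Sigma_mono)

lemma ancestor_fibre: "{c. ancestor M c = s} = {i. i div M = fst s} \<times> {j. j div M = snd s}"
  by (auto simp: ancestor_def prod_eq_iff)

lemma ancestor_fibre_card:
  assumes "M > 0"
  shows "finite {c. ancestor M c = s}" "card {c. ancestor M c = s} = M * M"
  using assms by (simp_all add: ancestor_fibre div_fibre card_cartesian_product)

lemma ancestor_vimage_card:
  assumes "M > 0" "finite S"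
  shows "finite {c. ancestor M c \<in> S}" "card {c. ancestor M c \<in> S} = card S * (M * M)"
proof -
  have eq: "{c. ancestor M c \<in> S} = (\<Union>s\<in>S. {c. ancestor M c = s})" by auto
  show "finite {c. ancestor M c \<in> S}" unfolding eq using assms ancestor_fibre_card by auto
  show "card {c. ancestor M c \<in> S} = card S * (M * M)"
    unfolding eq using assms ancestor_fibre_card by (subst card_UN_disjoint) auto
qed

text \<open>The region under the hyperbola is covered by the boxes with sides
  \<open>2^(-j)\<close> and \<open>2^(j+1) \<epsilon>\<close> for \<open>j \<le> J\<close>; the factor \<open>J + 1\<close> is one of the two logarithms.\<close>

lemma near_hyperbola_squares_card:
  fixes M q J :: nat and \<epsilon> h :: real
  assumes h: "h > 0" and M: "M > 0" and q: "q > 0" and qhM: "1 \<le> q * h * M"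
    and J: "q * h \<le> 1 / 2 ^ J" and \<epsilon>: "q * h \<le> \<epsilon>" and J\<epsilon>: "1 \<le> \<epsilon> * 2 ^ (J + 1)"
  shows "real (card {c. ancestor M c = s \<and>
           (\<exists>(x, y)\<in>square h c. nint_dist (q * x) * nint_dist (q * y) < \<epsilon>)})
         \<le> 288 * (real J + 1) * \<epsilon> * (M * M)" (is "real (card ?N) \<le> _")
proof -
  define X where "X u a = {i. i div M = u \<and> (\<exists>x\<in>cell h i. nint_dist (q * x) \<le> a)}" for u a
  define Y where "Y j = X (fst s) (1 / 2 ^ j) \<times> X (snd s) (\<epsilon> * 2 ^ (j + 1))" for j
  have Xfin: "finite (X u a)" for u a
    by (rule finite_subset[of _ "{i. i div M = u}"]) (force simp: X_def, simp add: div_fibre[OF M])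
  have \<epsilon>0: "\<epsilon> > 0" using \<epsilon> h q by (meson less_le_trans mult_pos_pos of_nat_0_less_iff)
  \<comment> \<open>The two sides contribute the proportions \<open>12 / 2 ^ j\<close> and
    \<open>12 * \<epsilon> * 2 ^ (j + 1)\<close>, whose product does not depend on
    \<open>j\<close>.\<close>
  have Ycard: "real (card (Y j)) \<le> 288 * \<epsilon> * (M * M)" if "j \<le> J" for j
  proof -
    have "(1::real) / 2 ^ J \<le> 1 / 2 ^ j" using that by (simp add: field_simps power_increasing)
    then have 1: "real (card (X (fst s) (1 / 2 ^ j))) \<le> 12 * (1 / 2 ^ j) * M"
      unfolding X_def using J by (intro near_rational_cells_card h M q qhM) linarith
    have "\<epsilon> * 1 \<le> \<epsilon> * 2 ^ (j + 1)" using \<epsilon>0 by (intro mult_left_mono one_le_power) auto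
    then have 2: "real (card (X (snd s) (\<epsilon> * 2 ^ (j + 1)))) \<le> 12 * (\<epsilon> * 2 ^ (j + 1)) * M"
      unfolding X_def using \<epsilon> by (intro near_rational_cells_card h M q qhM) linarith
    have "real (card (Y j)) \<le> (12 * (1 / 2 ^ j) * M) * (12 * (\<epsilon> * 2 ^ (j + 1)) * M)"
      unfolding Y_def card_cartesian_product of_nat_mult using 1 2 by (intro mult_mono) auto
    also have "\<dots> = 288 * \<epsilon> * (M * M)" by (simp add: field_simps)
    finally show ?thesis .
  qed
  have "?N \<subseteq> (\<Union>j\<in>{..J}. Y j)"
  proof
    fix c assume "c \<in> ?N"
    then obtain x y :: real where c: "ancestor M c = s" and x: "x \<in> cell h (fst c)" and y: "y \<in> cell h (snd c)"
      and lt: "nint_dist (q * x) * nint_dist (q * y) < \<epsilon>" by (auto simp: square_def)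
    \<comment> \<open>The greatest such \<open>j\<close> selects the box: for \<open>j < J\<close>
      maximality bounds the first factor from below and hence the second from above; for
      \<open>j = J\<close> the second side is at least 1 by \<open>J\<epsilon>\<close>.\<close>
    let ?P = "\<lambda>j. j \<le> J \<and> nint_dist (q * x) \<le> 1 / 2 ^ j"
    have "?P 0" using nint_dist_le_1 by simp
    then obtain j where j: "?P j" and jmax: "\<And>i. ?P i \<Longrightarrow> i \<le> j"
      using GreatestI_nat[of ?P 0 J] Greatest_le_nat[of ?P _ J] by blast
    have "nint_dist (q * y) \<le> \<epsilon> * 2 ^ (j + 1)"
    proof (cases "j = J")
      case True
      then show ?thesis using J\<epsilon> nint_dist_le_1[of "q * y"] by simp
    next
      case False
      then have "nint_dist (q * x) > 1 / 2 ^ (j + 1)" using j jmax[of "j + 1"] by fastforce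
      then have "1 / 2 ^ (j + 1) * nint_dist (q * y) \<le> nint_dist (q * x) * nint_dist (q * y)"
        by (intro mult_right_mono nint_dist_nonneg) simp
      then have "1 / 2 ^ (j + 1) * nint_dist (q * y) \<le> \<epsilon>" using lt by linarith
      then show ?thesis by (simp add: field_simps)
    qed
    then have "c \<in> Y j" using j x y c unfolding Y_def X_def by (auto simp: ancestor_def mem_Times_iff)
    then show "c \<in> (\<Union>j\<in>{..J}. Y j)" using j by auto
  qed
  then have "real (card ?N) \<le> (\<Sum>j\<in>{..J}. real (card (Y j)))"
    by (rule card_le_sum_cover) (use Xfin in \<open>auto simp: Y_def\<close>)
  also have "\<dots> \<le> (\<Sum>j\<in>{..J}. 288 * \<epsilon> * (M * M))" by (intro sum_mono Ycard) simp
  also have "\<dots> = 288 * (real J + 1) * \<epsilon> * (M * M)" by simp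
  finally show ?thesis .
qed

section \<open>One stage of the construction\<close>

text \<open>Stage \<open>n\<close> treats the \<open>q\<close> with \<open>log2 q\<close> in \<open>[4^n, 4^(n+1))\<close>, for which \<open>(log2 q)\<^sup>2 \<ge> 16^n\<close>. The
  thinnest boxes to be removed have width about \<open>1 / (2^16 q\<^sup>2 16^n)\<close>, which dictates \<open>level n\<close>. The
  ratio 4 of consecutive exponents makes the squares of stage \<open>n - 2\<close> wider than \<open>1 / q\<close>.\<close>

definition level :: "nat \<Rightarrow> nat" where
  "level n = 2 * 4 ^ (n + 1) + 4 * n + 16"

definition side :: "nat \<Rightarrow> real" where
  "side n = 1 / 2 ^ level n"

definition bad :: "nat \<Rightarrow> (real \<times> real) set" where
  "bad n = {(x, y). \<exists>q::nat. 2 ^ 4 ^ n \<le> q \<and> q < 2 ^ 4 ^ (n + 1) \<and>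
     nint_dist (q * x) * nint_dist (q * y) < 1 / (2 ^ 16 * real q * 16 ^ n)}"

text \<open>Each dyadic block contributes at most 1. Over one stage this sum is the second
  logarithm.\<close>

lemma sum_inverse_dyadic:
  assumes "a \<le> b"
  shows "(\<Sum>q = 2 ^ a..<2 ^ b. 1 / real q) \<le> real (b - a)"
  using assms
proof (induction b rule: dec_induct)
  case base
  then show ?case by simp
next
  case (step b)
  have le: "2 ^ b \<le> real q" if "2 ^ b \<le> q" for q :: nat
    using of_nat_mono[OF that, where 'a = real] by simp
  have "(\<Sum>q = 2 ^ b..<2 ^ Suc b. 1 / real q) \<le> (\<Sum>q = 2 ^ b..<(2::nat) ^ Suc b. 1 / 2 ^ b)"
    using le by (intro sum_mono divide_left_mono) auto
  also have "\<dots> = 1" by simp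
  finally have 1: "(\<Sum>q = 2 ^ b..<2 ^ Suc b. 1 / real q) \<le> 1" .
  have "(\<Sum>q = 2 ^ a..<2 ^ Suc b. 1 / real q)
      = (\<Sum>q = 2 ^ a..<2 ^ b. 1 / real q) + (\<Sum>q = 2 ^ b..<2 ^ Suc b. 1 / real q)"
    using step by (intro sum.atLeastLessThan_concat[symmetric]) (auto intro: power_increasing)
  with 1 step show ?case by (simp add: of_nat_diff)
qed

lemma level_mono: "m \<le> n \<Longrightarrow> level m \<le> level n"
  unfolding level_def by (intro add_mono mult_le_mono power_increasing) auto

lemma side_pos: "side n > 0"
  by (simp add: side_def)

lemma side_rescale:
  assumes "m \<le> n"
  shows "real (2 ^ (level n - level m)) * side n = side m"
proof -
  have "(2::real) ^ level n = 2 ^ (level n - level m) * 2 ^ level m"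
    using level_mono[OF assms] by (simp flip: power_add)
  then show ?thesis by (simp add: side_def)
qed

text \<open>It absorbs the linear part of \<open>level\<close>, so that
  \<open>level n \<le> 4 ^ (n + 2)\<close>: the squares of stage \<open>n\<close> are at least as
  wide as \<open>1 / q\<close> for every \<open>q\<close> of stage \<open>n + 2\<close>. It fails at
  \<open>n = 0\<close>, which is why stages start at 1.\<close>

lemma linear_le_pow4: "n \<ge> 1 \<Longrightarrow> 4 * n + 16 \<le> 2 * 4 ^ (n + 1)"
  by (induction n rule: nat_induct_at_least) auto

text \<open>A single \<open>q\<close> spoils a proportion of at most
  \<open>288 * (8 * 4 ^ k) / (2 ^ 16 * q * 16 ^ k)\<close>. Summing \<open>1 / q\<close> brings
  another \<open>3 * 4 ^ k\<close>; the powers of 4 cancel against \<open>16 ^ k\<close>, and the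
  constant \<open>2 ^ 16\<close> in \<open>bad\<close> makes the remaining
  \<open>6912 / 2 ^ 16\<close> smaller than 1/8.\<close>

lemma bad_squares_card:
  assumes n: "n \<ge> 1" and k: "k = n + 2"
  defines "M \<equiv> 2 ^ (level k - level n)"
  shows "real (card {c. ancestor M c = s \<and> square (side k) c \<inter> bad k \<noteq> {}})
         \<le> real (M * M) / 8" (is "real (card ?N) \<le> _")
proof -
  let ?h = "side k"
  define Q :: "nat set" where "Q = {2 ^ 4 ^ k..<2 ^ 4 ^ (k + 1)}"
  \<comment> \<open>Chosen so that \<open>level k = 4 ^ (k + 1) + J\<close>: magnified by any
    \<open>q\<close> of the stage, a fine square has side at most \<open>1 / 2 ^ J\<close>, which in
    turn is at most the threshold of the hyperbola.\<close>
  define J where "J = 4 ^ (k + 1) + 4 * k + 16"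
  define N where "N q = {c. ancestor M c = s \<and>
      (\<exists>(x, y)\<in>square ?h c. nint_dist (q * x) * nint_dist (q * y) < 1 / (2 ^ 16 * real q * 16 ^ k))}"
    for q :: nat
  have M: "M > 0" by (simp add: M_def)
  have J1: "real J + 1 \<le> 8 * 4 ^ k"
  proof -
    have "J + 1 \<le> 8 * 4 ^ k" using linear_le_pow4[OF n] by (simp add: J_def k)
    then have "real (J + 1) \<le> real (8 * 4 ^ k)" by (simp only: of_nat_le_iff)
    then show ?thesis by (simp only: of_nat_add of_nat_1 of_nat_mult of_nat_numeral of_nat_power)
  qed
  have levJ: "level k = 4 ^ (k + 1) + J" by (simp add: level_def J_def)
  have Ncard: "real (card (N q)) \<le> 288 * (8 * 4 ^ k) * (1 / (2 ^ 16 * real q * 16 ^ k)) * (M * M)"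
    if "q \<in> Q" for q
  proof -
    have q: "2 ^ 4 ^ k \<le> q" "q < 2 ^ 4 ^ (k + 1)" using that by (auto simp: Q_def)
    have q0: "q > 0" using q(1) by (meson less_le_trans zero_less_numeral zero_less_power)
    have qr: "real q \<le> 2 ^ 4 ^ (k + 1)"
      using q(2) by (metis less_imp_le of_nat_le_iff of_nat_numeral of_nat_power)
    have qr': "2 ^ 4 ^ k \<le> real q"
      using q(1) by (metis of_nat_le_iff of_nat_numeral of_nat_power)
    have "real q * ?h \<le> 2 ^ 4 ^ (k + 1) * ?h" using qr side_pos[of k] by (intro mult_right_mono) auto
    also have "\<dots> = 1 / 2 ^ J" unfolding side_def levJ power_add by simp
    finally have qhJ: "real q * ?h \<le> 1 / 2 ^ J" .
    have e: "2 ^ 16 * real q * 16 ^ k \<le> 2 ^ J"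
    proof -
      have "2 ^ 16 * real q * 16 ^ k \<le> 2 ^ 16 * 2 ^ 4 ^ (k + 1) * 16 ^ k"
        using qr by (intro mult_mono) auto
      also have "\<dots> = 2 ^ 16 * 2 ^ 4 ^ (k + 1) * 2 ^ (4 * k)" by (simp only: power_mult) simp
      also have "\<dots> = 2 ^ J"
        unfolding J_def power_add by simp
      finally show ?thesis .
    qed
    then have e': "1 / 2 ^ J \<le> 1 / (2 ^ 16 * real q * 16 ^ k)"
      using q0 by (intro divide_left_mono) auto
    then have "1 / 2 ^ J * 2 ^ (J + 1) \<le> 1 / (2 ^ 16 * real q * 16 ^ k) * 2 ^ (J + 1)"
      by (intro mult_right_mono) auto
    moreover have "(1::real) / 2 ^ J * 2 ^ (J + 1) = 2" by simp
    ultimately have e'': "1 \<le> 1 / (2 ^ 16 * real q * 16 ^ k) * 2 ^ (J + 1)" by linarith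
    have "level n \<le> 4 ^ k" using linear_le_pow4[OF n] by (simp add: level_def k)
    then have "(2::real) ^ level n \<le> 2 ^ 4 ^ k" by (intro power_increasing) auto
    then have "(2::real) ^ level n \<le> real q" using qr' by linarith
    then have "1 \<le> real q * side n" by (simp add: side_def)
    then have qhM: "1 \<le> real q * ?h * M" using side_rescale[of n k] k by (simp add: M_def mult_ac)
    have "real (card (N q)) \<le> 288 * (real J + 1) * (1 / (2 ^ 16 * real q * 16 ^ k)) * (M * M)"
      unfolding N_def
      by (rule near_hyperbola_squares_card[OF side_pos M q0 qhM qhJ order_trans[OF qhJ e'] e''])
    also have "\<dots> \<le> 288 * (8 * 4 ^ k) * (1 / (2 ^ 16 * real q * 16 ^ k)) * (M * M)"
      using J1 by (intro mult_right_mono mult_left_mono) auto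
    finally show ?thesis .
  qed
  have Nfin: "finite (N q)" for q
    by (rule finite_subset[OF _ ancestor_fibre_card(1)[OF M, of s]]) (auto simp: N_def)
  have "?N \<subseteq> (\<Union>q\<in>Q. N q)" by (fastforce simp: bad_def N_def Q_def)
  then have "real (card ?N) \<le> (\<Sum>q\<in>Q. real (card (N q)))"
    by (rule card_le_sum_cover) (use Nfin in \<open>auto simp: Q_def\<close>)
  also have "\<dots> \<le> (\<Sum>q\<in>Q. 288 * (8 * 4 ^ k) * (1 / (2 ^ 16 * real q * 16 ^ k)) * (M * M))"
    by (intro sum_mono Ncard)
  also have "\<dots> = (\<Sum>q\<in>Q. 288 * (8 * 4 ^ k) / (2 ^ 16 * 16 ^ k) * (M * M) * (1 / real q))"
    by (intro sum.cong) (auto simp: field_simps)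
  also have "\<dots> = 288 * (8 * 4 ^ k) / (2 ^ 16 * 16 ^ k) * (M * M) * (\<Sum>q\<in>Q. 1 / real q)"
    by (simp only: sum_distrib_left)
  also have "\<dots> \<le> 288 * (8 * 4 ^ k) / (2 ^ 16 * 16 ^ k) * (M * M) * (3 * 4 ^ k)"
  proof (intro mult_left_mono)
    have "(\<Sum>q\<in>Q. 1 / real q) \<le> real (4 ^ (k + 1) - 4 ^ k)"
      unfolding Q_def by (rule sum_inverse_dyadic) simp
    also have "4 ^ (k + 1) - 4 ^ k = 3 * (4::nat) ^ k" by simp
    finally show "(\<Sum>q\<in>Q. 1 / real q) \<le> 3 * 4 ^ k" by simp
  qed auto
  also have "\<dots> = 6912 / 2 ^ 16 * (M * M) * (4 ^ k * 4 ^ k / 16 ^ k)" by simp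
  also have "\<dots> = 6912 / 2 ^ 16 * (M * M)"
    by (simp flip: power_mult_distrib)
  also have "\<dots> \<le> (M * M) / 8" by simp
  finally show ?thesis .
qed

section \<open>Survivors\<close>

text \<open>Indices at stage \<open>m\<close> refer to squares of side \<open>1 / 2 ^ K m\<close>,
  and \<open>T m\<close> holds those discarded at that scale. Stage 0 is the whole unit
  square.\<close>

fun survivors :: "(nat \<Rightarrow> nat) \<Rightarrow> (nat \<Rightarrow> (nat \<times> nat) set) \<Rightarrow> nat \<Rightarrow> (nat \<times> nat) set" where
  "survivors K T 0 = {..<2 ^ K 0} \<times> {..<2 ^ K 0}"
| "survivors K T (Suc m) = {c. ancestor (2 ^ (K (Suc m) - K m)) c \<in> survivors K T m} - T (Suc m)"

lemma finite_survivors: "finite (survivors K T m)"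
  by (induction m) (simp_all add: ancestor_vimage_card)

text \<open>The sets removed at a stage are equidistributed only relative to the squares of two stages
  before. Since at least half of the area survives each single stage, losing an eighth of the
  older area costs at most a quarter of the present one.\<close>

lemma survivors_card:
  fixes K :: "nat \<Rightarrow> nat"
  assumes K: "\<And>m. K m \<le> K (Suc m)"
    and T1: "T (Suc 0) = {}"
    and T: "\<And>m. T (Suc (Suc m)) \<subseteq> A m \<union> V m"
    and A: "\<And>m s. real (card {c \<in> A m. ancestor (2 ^ (K (Suc (Suc m)) - K m)) c = s})
                  \<le> 4 ^ (K (Suc (Suc m)) - K m) / 8"
    and V: "\<And>m. finite (V m)" "\<And>m. real (card (V m)) \<le> 4 ^ K (Suc (Suc m)) / (8 * 2 ^ m)"
  shows "4 ^ K m / 2 ^ m \<le> real (card (survivors K T m))"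
proof -
  define S where "S = survivors K T"
  \<comment> \<open>The surviving area.\<close>
  define d where "d m = real (card (S m)) / 4 ^ K m" for m
  have fin: "finite (S m)" for m unfolding S_def by (rule finite_survivors)
  have pow: "(4::real) ^ (K n - K m) * 4 ^ K m = 4 ^ K n" if "K m \<le> K n" for m n
    using that by (simp flip: power_add)
  have sq: "real (2 ^ k * 2 ^ k) = 4 ^ k" for k by (simp flip: power_mult_distrib)
  have lift: "real (card {c. ancestor (2 ^ (K (Suc m) - K m)) c \<in> S m}) = d m * 4 ^ K (Suc m)" for m
    using pow[OF K, of m]
    by (simp add: ancestor_vimage_card fin d_def field_simps flip: sq)
  have d0: "d 0 = 1"
    by (simp add: d_def S_def card_cartesian_product flip: power_mult_distrib)
  \<comment> \<open>Nothing is removed at the first stage, which supplies the second initial value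
    of the two-step recurrence \<open>step\<close>.\<close>
  have d1: "d 1 = 1"
  proof -
    have "S (Suc 0) = {c. ancestor (2 ^ (K (Suc 0) - K 0)) c \<in> S 0}" by (simp add: S_def T1)
    then show ?thesis using lift[of 0] d0 by (simp add: d_def)
  qed
  have step: "d (Suc m) - d m / 8 - 1 / (8 * 2 ^ m) \<le> d (Suc (Suc m))" for m
  proof -
    let ?M = "2 ^ (K (Suc (Suc m)) - K (Suc m)) :: nat"
    let ?M2 = "2 ^ (K (Suc (Suc m)) - K m) :: nat"
    let ?L = "{c. ancestor ?M c \<in> S (Suc m)}"
    let ?F = "\<lambda>s. {c \<in> A m. ancestor ?M2 c = s}"
    have M2: "?M2 = ?M * 2 ^ (K (Suc m) - K m)"
      using K[of m] K[of "Suc m"] by (simp flip: power_add)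
    have anc: "ancestor ?M2 c \<in> S m" if "c \<in> ?L" for c
    proof -
      have "ancestor (2 ^ (K (Suc m) - K m)) (ancestor ?M c) \<in> S m" using that by (simp add: S_def)
      then show ?thesis by (simp only: ancestor_ancestor M2)
    qed
    have Ffin: "finite (?F s)" for s
      by (rule finite_subset[OF _ ancestor_fibre_card(1)[of ?M2 s]]) auto
    have "real (card (A m \<inter> ?L)) \<le> (\<Sum>s\<in>S m. real (card (?F s)))"
      by (rule card_le_sum_cover) (use anc fin Ffin in auto)
    also have "\<dots> \<le> (\<Sum>s\<in>S m. 4 ^ (K (Suc (Suc m)) - K m) / 8)" by (intro sum_mono A)
    also have "\<dots> = d m / 8 * 4 ^ K (Suc (Suc m))"
      using pow[of m "Suc (Suc m)"] K[of m] K[of "Suc m"] by (simp add: d_def field_simps)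
    finally have Ac: "real (card (A m \<inter> ?L)) \<le> d m / 8 * 4 ^ K (Suc (Suc m))" .
    have Lfin: "finite ?L" by (rule ancestor_vimage_card(1)) (auto simp: fin)
    have "?L \<subseteq> S (Suc (Suc m)) \<union> ((A m \<inter> ?L) \<union> V m)" using T[of m] by (auto simp: S_def)
    then have "card ?L \<le> card (S (Suc (Suc m)) \<union> ((A m \<inter> ?L) \<union> V m))"
      using Lfin fin V(1) by (intro card_mono) auto
    also have "\<dots> \<le> card (S (Suc (Suc m))) + card ((A m \<inter> ?L) \<union> V m)" by (rule card_Un_le)
    also have "\<dots> \<le> card (S (Suc (Suc m))) + (card (A m \<inter> ?L) + card (V m))"
      using card_Un_le by simp
    finally have "real (card ?L) \<le> real (card (S (Suc (Suc m)))) + (real (card (A m \<inter> ?L)) + real (card (V m)))"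
      by (simp only: flip: of_nat_add of_nat_le_iff)
    also have "\<dots> \<le> d (Suc (Suc m)) * 4 ^ K (Suc (Suc m)) + (d m / 8 * 4 ^ K (Suc (Suc m))
        + 4 ^ K (Suc (Suc m)) / (8 * 2 ^ m))"
      using Ac V(2)[of m] by (simp add: d_def)
    also have "\<dots> = (d (Suc (Suc m)) + d m / 8 + 1 / (8 * 2 ^ m)) * 4 ^ K (Suc (Suc m))"
      by (simp add: field_simps)
    finally have "d (Suc m) * 4 ^ K (Suc (Suc m))
        \<le> (d (Suc (Suc m)) + d m / 8 + 1 / (8 * 2 ^ m)) * 4 ^ K (Suc (Suc m))"
      unfolding lift .
    then have "d (Suc m) \<le> d (Suc (Suc m)) + d m / 8 + 1 / (8 * 2 ^ m)"
      by (rule mult_right_le_imp_le) simp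
    then show ?thesis by linarith
  qed
  \<comment> \<open>Both invariants go together: by them \<open>d m\<close> and
    \<open>1 / 2 ^ m\<close> are at most \<open>2 * d (Suc m)\<close>, so each of the two losses in
    \<open>step\<close> is at most a quarter of \<open>d (Suc m)\<close>.\<close>
  have "1 / 2 ^ m \<le> d m \<and> d m / 2 \<le> d (Suc m)" for m
  proof (induction m)
    case 0
    then show ?case using d0 d1 by simp
  next
    case (Suc m)
    define e :: real where "e = 1 / 2 ^ m"
    have "1 / (8 * 2 ^ m) = e / 8" "1 / 2 ^ Suc m = e / 2" by (simp_all add: e_def)
    then show ?case
      using Suc.IH[THEN conjunct1, folded e_def] Suc.IH[THEN conjunct2] step[of m]
      by (intro conjI) linarith+
  qed
  then have "1 / 2 ^ m \<le> real (card (S m)) / 4 ^ K m" by (simp add: d_def)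
  then show ?thesis by (simp add: S_def field_simps)
qed

lemma compact_square: "compact (square h c)"
  by (simp add: square_def cell_def compact_Times)

text \<open>The unions of the surviving squares form a decreasing sequence of nonempty compact
  sets.\<close>

lemma survivors_limit_point:
  assumes K: "\<And>m. K m \<le> K (Suc m)" and ne: "\<And>m. survivors K T m \<noteq> {}"
  shows "\<exists>z. \<forall>m. \<exists>c\<in>survivors K T m. z \<in> square (1 / 2 ^ K m) c"
proof -
  define F where "F m = (\<Union>c\<in>survivors K T m. square (1 / 2 ^ K m) c)" for m
  have "F (Suc m) \<subseteq> F m" for m
  proof
    fix z assume "z \<in> F (Suc m)"
    then obtain c where c: "c \<in> survivors K T (Suc m)" "z \<in> square (1 / 2 ^ K (Suc m)) c"
      by (auto simp: F_def)
    let ?M = "2 ^ (K (Suc m) - K m) :: nat"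
    have "(2::real) ^ K (Suc m) = 2 ^ (K (Suc m) - K m) * 2 ^ K m" using K[of m] by (simp flip: power_add)
    then have "real ?M * (1 / 2 ^ K (Suc m)) = 1 / 2 ^ K m" by simp
    then have "z \<in> square (1 / 2 ^ K m) (ancestor ?M c)"
      using square_subset_ancestor[of "1 / 2 ^ K (Suc m)" ?M c] c(2) by auto
    then show "z \<in> F m" using c(1) by (auto simp: F_def)
  qed
  then have "m \<le> n \<Longrightarrow> F n \<subseteq> F m" for m n by (rule lift_Suc_antimono_le)
  moreover have "compact (F m)" for m
    unfolding F_def by (intro compact_UN finite_survivors compact_square)
  moreover have "F m \<noteq> {}" for m
  proof -
    obtain c where c: "c \<in> survivors K T m" using ne[of m] by blast
    have "(real (fst c) * (1 / 2 ^ K m), real (snd c) * (1 / 2 ^ K m)) \<in> square (1 / 2 ^ K m) c"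
      by (auto simp: square_def cell_def divide_simps)
    then show ?thesis using c unfolding F_def by blast
  qed
  ultimately have "\<Inter>(range F) \<noteq> {}" by (intro compact_nest) auto
  then obtain z where "\<And>m. z \<in> F m" by blast
  then show ?thesis unfolding F_def by blast
qed

section \<open>Avoiding a cover\<close>

text \<open>\<open>U\<close> fits into a box of side \<open>2 * r\<close> around any of its points,
  and since \<open>h \<le> r\<close> such a box meets at most \<open>4 * (r / h)\<close> cells in
  each direction. Bounding distances by \<open>r\<close> allows \<open>r\<close> to exceed the
  diameter.\<close>

lemma squares_meet_small_set_card:
  fixes U :: "(real \<times> real) set"
  assumes h: "h > 0" "h \<le> r" and U: "\<And>x y. x \<in> U \<Longrightarrow> y \<in> U \<Longrightarrow> dist x y \<le> r"
  shows "finite {c. square h c \<inter> U \<noteq> {}}"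
    and "real (card {c. square h c \<inter> U \<noteq> {}}) \<le> 16 * (r / h)\<^sup>2"
proof -
  let ?W = "{c. square h c \<inter> U \<noteq> {}}"
  define I where "I x = {i. cell h i \<inter> {x - r..x + r} \<noteq> {}}" for x
  have I: "finite (I x)" "real (card (I x)) \<le> 4 * (r / h)" for x
  proof -
    have le: "x - r \<le> x + r" using h by linarith
    show "finite (I x)" unfolding I_def by (rule cells_meet_interval(1)[OF h(1) le])
    have "real (card (I x)) \<le> (x + r - (x - r)) / h + 2"
      unfolding I_def by (rule cells_meet_interval(2)[OF h(1) le])
    also have "\<dots> = 2 * (r / h) + 2 * 1" by simp
    also have "\<dots> \<le> 2 * (r / h) + 2 * (r / h)" using h by (intro add_mono mult_left_mono) auto
    finally show "real (card (I x)) \<le> 4 * (r / h)" by simp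
  qed
  have "finite ?W \<and> real (card ?W) \<le> 16 * (r / h)\<^sup>2"
  proof (cases "U = {}")
    case False
    then obtain z where z: "z \<in> U" by blast
    have sub: "?W \<subseteq> I (fst z) \<times> I (snd z)"
    proof
      fix c assume "c \<in> ?W"
      then obtain w where w: "w \<in> square h c" "w \<in> U" by blast
      have "dist (fst w) (fst z) \<le> r" "dist (snd w) (snd z) \<le> r"
        using U[OF w(2) z] dist_fst_le[of w z] dist_snd_le[of w z] by linarith+
      then have "fst w \<in> {fst z - r..fst z + r}" "snd w \<in> {snd z - r..snd z + r}"
        by (auto simp: dist_real_def)
      with w(1) show "c \<in> I (fst z) \<times> I (snd z)"
        unfolding I_def square_def mem_Times_iff by blast
    qed
    have fin: "finite (I (fst z) \<times> I (snd z))" using I by simp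
    have "real (card ?W) \<le> real (card (I (fst z) \<times> I (snd z)))"
      using card_mono[OF fin sub] by simp
    also have "\<dots> \<le> (4 * (r / h)) * (4 * (r / h))"
      unfolding card_cartesian_product of_nat_mult using h by (intro mult_mono I) auto
    also have "\<dots> = 16 * (r / h)\<^sup>2" by (simp add: power2_eq_square)
    finally show ?thesis using finite_subset[OF sub fin] by simp
  qed simp
  then show "finite ?W" "real (card ?W) \<le> 16 * (r / h)\<^sup>2" by auto
qed

lemma side_antimono: "m \<le> n \<Longrightarrow> side n \<le> side m"
  unfolding side_def by (intro divide_left_mono power_increasing level_mono) auto

lemma ex_side_le:
  assumes "r > 0"
  shows "\<exists>n. side n \<le> r"
proof -
  obtain n where n: "(1 / 2) ^ n < r" using real_arch_pow_inv[OF assms, of "1 / 2"] by auto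
  have "(2::real) ^ n \<le> 2 ^ level n" by (intro power_increasing) (auto simp: level_def)
  then have "side n \<le> (1 / 2) ^ n" by (simp add: side_def field_simps)
  then show ?thesis using n by (intro exI[of _ n]) linarith
qed

text \<open>If \<open>n * (2 - t)\<close> is at least 1, this gives
  \<open>side (n + m + 1) powr (2 - t) \<le> 1 / 2 ^ (m + 7)\<close>, which keeps pace with a
  surviving area that may shrink like \<open>1 / 2 ^ m\<close>.\<close>

lemma level_ge_mult: "n * (m + 7) \<le> level (n + m + 1)"
proof -
  have "m + 7 \<le> 32 * 4 ^ m" by (induction m) auto
  moreover have "n \<le> 4 ^ n" by (intro less_imp_le power_gt_expt) simp
  ultimately have "n * (m + 7) \<le> 4 ^ n * (32 * 4 ^ m)" by (intro mult_le_mono)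
  also have "\<dots> = 2 * 4 ^ (n + m + 1 + 1)" by (simp add: power_add)
  also have "\<dots> \<le> level (n + m + 1)" by (simp add: level_def)
  finally show ?thesis .
qed

text \<open>The survivor scheme is started at level \<open>n0\<close>. A set \<open>U i\<close>
  meets at most \<open>16 * (r i / side n)\<^sup>2\<close> squares of its stage \<open>n\<close>;
  splitting \<open>(r i)\<^sup>2\<close> into \<open>r i powr t\<close> and the small factor
  \<open>r i powr (2 - t)\<close> lets the convergent sum control the total area removed.\<close>

lemma ex_point_avoiding_cover_and_bad:
  fixes U :: "nat \<Rightarrow> (real \<times> real) set" and r :: "nat \<Rightarrow> real"
  assumes n0: "n0 \<ge> 1" and t: "0 < t" "t < 2" "1 \<le> real n0 * (2 - t)"
    and r: "\<And>i. 0 < r i" "\<And>i. r i < side (n0 + 1)"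
    and U: "\<And>i x y. x \<in> U i \<Longrightarrow> y \<in> U i \<Longrightarrow> dist x y \<le> r i"
    and sm: "summable (\<lambda>i. r i powr t)" "(\<Sum>i. r i powr t) \<le> 1"
  shows "\<exists>z. (\<forall>i. z \<notin> U i) \<and> (\<forall>n\<ge>n0 + 2. z \<notin> bad n)"
proof -
  define K where "K m = level (n0 + m)" for m
  define A where "A m = {c. square (side (n0 + m + 2)) c \<inter> bad (n0 + m + 2) \<noteq> {}}" for m
  \<comment> \<open>Each \<open>U i\<close> is assigned to the first stage whose squares are no
    wider than \<open>r i\<close>.\<close>
  define I where "I m = {i. side (n0 + m + 2) \<le> r i \<and> r i < side (n0 + m + 1)}" for m
  define W where "W m i = {c. square (side (n0 + m + 2)) c \<inter> U i \<noteq> {}}" for m i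
  define V where "V m = (\<Union>i\<in>I m. W m i)" for m
  \<comment> \<open>Removal starts at stage 2, since \<open>A m\<close> is controlled only relative
    to squares two stages older.\<close>
  define T where "T m = (if m \<ge> 2 then A (m - 2) \<union> V (m - 2) else {})" for m
  have K: "K m \<le> K (Suc m)" for m by (simp add: K_def level_mono)
  have K2: "K (Suc (Suc m)) = level (n0 + m + 2)" for m by (simp add: K_def)
  \<comment> \<open>Only finitely many terms of a convergent series exceed a positive bound.\<close>
  have Ifin: "finite (I m)" for m
  proof -
    have "side (n0 + m + 2) powr t > 0" using side_pos[of "n0 + m + 2"] by simp
    then have "eventually (\<lambda>i. r i powr t < side (n0 + m + 2) powr t) sequentially"
      using summable_LIMSEQ_zero[OF sm(1)] by (rule order_tendstoD(2)[rotated])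
    then obtain N where N: "\<And>i. i \<ge> N \<Longrightarrow> r i powr t < side (n0 + m + 2) powr t"
      by (auto simp: eventually_sequentially)
    have "I m \<subseteq> {..<N}"
    proof
      fix i assume "i \<in> I m"
      then have "side (n0 + m + 2) powr t \<le> r i powr t"
        using t side_pos[of "n0 + m + 2"] by (intro powr_mono2) (auto simp: I_def)
      then show "i \<in> {..<N}" using N[of i] by force
    qed
    then show ?thesis by (rule finite_subset) simp
  qed
  have W: "finite (W m i)" "real (card (W m i)) \<le> 16 * (r i / side (n0 + m + 2))\<^sup>2" if "i \<in> I m" for m i
    using squares_meet_small_set_card[OF side_pos _ U, of "n0 + m + 2" i] that
    unfolding W_def I_def by auto
  \<comment> \<open>Here 128 is 16 times 8: the 16 comes from counting squares that meet
    \<open>U i\<close>, the 8 from the loss that \<open>survivors_card\<close> tolerates.\<close>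
  have small: "side (n0 + m + 1) powr (2 - t) \<le> 1 / (128 * 2 ^ m)" for m
  proof -
    have "real (m + 7) * 1 \<le> real (m + 7) * (real n0 * (2 - t))" using t(3) by (intro mult_left_mono) auto
    also have "\<dots> = real (n0 * (m + 7)) * (2 - t)" by simp
    also have "\<dots> \<le> real (level (n0 + m + 1)) * (2 - t)"
      using level_ge_mult[of n0 m] t(2) by (intro mult_right_mono of_nat_mono) auto
    finally have le: "real (m + 7) \<le> real (level (n0 + m + 1)) * (2 - t)" by simp
    have "side (n0 + m + 1) = 2 powr (- real (level (n0 + m + 1)))"
      by (simp add: side_def powr_minus_divide powr_realpow)
    then have "side (n0 + m + 1) powr (2 - t) = 2 powr (- (real (level (n0 + m + 1)) * (2 - t)))"
      by (simp add: powr_powr)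
    also have "\<dots> \<le> 2 powr (- real (m + 7))" using le by (intro powr_mono) auto
    also have "\<dots> = 1 / 2 ^ (m + 7)" unfolding powr_minus_divide by (subst powr_realpow) auto
    also have "\<dots> = 1 / (128 * 2 ^ m)" by (simp add: power_add)
    finally show ?thesis .
  qed
  have Vfin: "finite (V m)" for m using Ifin W(1) by (auto simp: V_def)
  have Vcard: "real (card (V m)) \<le> 4 ^ K (Suc (Suc m)) / (8 * 2 ^ m)" for m
  proof -
    have "real (card (V m)) \<le> (\<Sum>i\<in>I m. real (card (W m i)))"
      by (rule card_le_sum_cover) (use Ifin W(1) in \<open>auto simp: V_def\<close>)
    also have "\<dots> \<le> (\<Sum>i\<in>I m. r i powr t * (16 * 4 ^ K (Suc (Suc m)) / (128 * 2 ^ m)))"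
    proof (rule sum_mono)
      fix i assume i: "i \<in> I m"
      have "(r i)\<^sup>2 = r i powr t * r i powr (2 - t)"
        using r(1)[of i] by (simp flip: powr_add add: powr_numeral)
      also have "\<dots> \<le> r i powr t * (1 / (128 * 2 ^ m))"
      proof (intro mult_left_mono order_trans[OF _ small])
        show "r i powr (2 - t) \<le> side (n0 + m + 1) powr (2 - t)"
          using i t r(1)[of i] by (intro powr_mono2) (auto simp: I_def)
      qed auto
      finally have r2: "(r i)\<^sup>2 \<le> r i powr t * (1 / (128 * 2 ^ m))" .
      have "(r i / side (n0 + m + 2))\<^sup>2 = (r i)\<^sup>2 * 4 ^ K (Suc (Suc m))"
        unfolding K2 side_def
        by (simp add: power_mult_distrib power2_eq_square flip: power_mult_distrib[of 2 2])
      also have "\<dots> \<le> r i powr t * (1 / (128 * 2 ^ m)) * 4 ^ K (Suc (Suc m))"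
        using r2 by (intro mult_right_mono) auto
      finally have "real (card (W m i)) \<le> 16 * (r i powr t * (1 / (128 * 2 ^ m)) * 4 ^ K (Suc (Suc m)))"
        using W(2)[OF i] by linarith
      then show "real (card (W m i)) \<le> r i powr t * (16 * 4 ^ K (Suc (Suc m)) / (128 * 2 ^ m))"
        by simp
    qed
    also have "\<dots> = (\<Sum>i\<in>I m. r i powr t) * (4 ^ K (Suc (Suc m)) / (8 * 2 ^ m))"
      by (simp add: sum_distrib_right sum_divide_distrib)
    also have "\<dots> \<le> 1 * (4 ^ K (Suc (Suc m)) / (8 * 2 ^ m))"
    proof (rule mult_right_mono)
      have "(\<Sum>i\<in>I m. r i powr t) \<le> (\<Sum>i. r i powr t)"
        using sm(1) Ifin by (intro sum_le_suminf) auto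
      then show "(\<Sum>i\<in>I m. r i powr t) \<le> 1" using sm(2) by linarith
    qed simp
    finally show ?thesis by simp
  qed
  have Acard: "real (card {c \<in> A m. ancestor (2 ^ (K (Suc (Suc m)) - K m)) c = s})
      \<le> 4 ^ (K (Suc (Suc m)) - K m) / 8" for m s
  proof -
    have "{c \<in> A m. ancestor (2 ^ (K (Suc (Suc m)) - K m)) c = s}
       = {c. ancestor (2 ^ (level (n0 + m + 2) - level (n0 + m))) c = s \<and>
             square (side (n0 + m + 2)) c \<inter> bad (n0 + m + 2) \<noteq> {}}"
      unfolding A_def K2 by (auto simp: K_def)
    moreover have "real (2 ^ k * 2 ^ k) = 4 ^ k" for k by (simp flip: power_mult_distrib)
    ultimately show ?thesis
      using bad_squares_card[of "n0 + m" "n0 + m + 2" s] n0 unfolding K2 by (simp add: K_def)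
  qed
  have "4 ^ K m / 2 ^ m \<le> real (card (survivors K T m))" for m
    by (rule survivors_card[OF K _ _ Acard Vfin Vcard]) (auto simp: T_def)
  moreover have "(0::real) < 4 ^ K m / 2 ^ m" for m by simp
  ultimately have "0 < real (card (survivors K T m))" for m by (meson less_le_trans)
  then have "survivors K T m \<noteq> {}" for m by (metis card.empty of_nat_0 less_irrefl)
  then obtain z where z: "\<And>m. \<exists>c\<in>survivors K T m. z \<in> square (1 / 2 ^ K m) c"
    using survivors_limit_point[of K T] K by blast
  have sep: "\<exists>c. z \<in> square (side (n0 + m + 2)) c \<and> c \<notin> A m \<and> c \<notin> V m" for m
  proof -
    obtain c where c: "c \<in> survivors K T (Suc (Suc m))" "z \<in> square (1 / 2 ^ K (Suc (Suc m))) c"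
      using z[of "Suc (Suc m)"] by blast
    have "c \<notin> T (Suc (Suc m))" using c(1) by simp
    then have "c \<notin> A m" "c \<notin> V m" by (auto simp: T_def)
    then show ?thesis using c(2) unfolding K2 side_def[symmetric] by blast
  qed
  have "z \<notin> bad n" if n: "n \<ge> n0 + 2" for n
  proof -
    define m where "m = n - (n0 + 2)"
    have nm: "n = n0 + m + 2" using n by (simp add: m_def)
    show ?thesis using sep[of m] unfolding nm A_def by blast
  qed
  moreover have "z \<notin> U i" for i
  proof
    assume zU: "z \<in> U i"
    \<comment> \<open>The stage at which \<open>U i\<close> was removed;
      \<open>r i < side (n0 + 1)\<close> ensures that it is late enough for removal to take
      place.\<close>
    define n where "n = (LEAST n. side n \<le> r i)"
    have n: "side n \<le> r i" unfolding n_def using ex_side_le[OF r(1)] by (rule LeastI_ex)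
    have "n0 + 1 < n"
    proof (rule ccontr)
      assume "\<not> n0 + 1 < n"
      then have "side (n0 + 1) \<le> side n" by (intro side_antimono) simp
      then show False using n r(2)[of i] by linarith
    qed
    define m where "m = n - (n0 + 2)"
    have nm: "n = n0 + m + 2" using \<open>n0 + 1 < n\<close> by (simp add: m_def)
    have "\<not> side (n0 + m + 1) \<le> r i"
      using not_less_Least[of "n0 + m + 1" "\<lambda>n. side n \<le> r i"] nm unfolding n_def by simp
    then have "i \<in> I m" using n unfolding I_def nm by simp
    then show False using sep[of m] zU unfolding V_def W_def by blast
  qed
  ultimately show ?thesis by blast
qed

section \<open>The upper bound\<close>

text \<open>The quantity equals \<open>2 powr s * N powr (2 - s)\<close>, which tends to 0. The
  length \<open>2 / N\<close> is a crude bound for the diameter of a square of side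
  \<open>1 / N\<close>.\<close>

lemma ex_grid_refinement:
  fixes s \<delta> e :: real
  assumes s: "s > 2" and \<delta>: "\<delta> > 0" and e: "e > 0"
  shows "\<exists>N::nat. N > 0 \<and> 2 / N \<le> \<delta> \<and> real (N * N) * (2 / N) powr s \<le> e"
proof -
  have "((\<lambda>N::nat. 2 / real N) \<longlongrightarrow> 0) sequentially"
    by (rule lim_const_over_n)
  then have 1: "eventually (\<lambda>N::nat. 2 / real N < \<delta>) sequentially"
    using \<delta> by (rule order_tendstoD(2))
  have "((\<lambda>N::nat. real N powr (2 - s)) \<longlongrightarrow> 0) sequentially"
    using s by (intro tendsto_neg_powr filterlim_real_sequentially) auto
  then have "((\<lambda>N::nat. 2 powr s * real N powr (2 - s)) \<longlongrightarrow> 0) sequentially"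
    by (rule tendsto_mult_right_zero)
  then have 2: "eventually (\<lambda>N::nat. 2 powr s * real N powr (2 - s) < e) sequentially"
    using e by (rule order_tendstoD(2))
  obtain N :: nat where N: "N > 0" "2 / real N < \<delta>" "2 powr s * real N powr (2 - s) < e"
    using eventually_happens[OF eventually_conj[OF eventually_gt_at_top[of 0] eventually_conj[OF 1 2]]]
    by auto
  have "real (N * N) * (2 / N) powr s = 2 powr s * real N powr (2 - s)"
    using N(1) by (simp add: powr_divide powr_diff power2_eq_square)
  then show ?thesis using N by (intro exI[of _ N]) auto
qed

lemma unit_interval_grid:
  fixes x :: real and N :: nat
  assumes "N > 0"
  shows "\<exists>i<N. x \<in> {of_int \<lfloor>x\<rfloor> + i / N .. of_int \<lfloor>x\<rfloor> + i / N + 1 / N}"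
proof -
  define i where "i = nat \<lfloor>frac x * N\<rfloor>"
  have i: "real i \<le> frac x * N" "frac x * N < real i + 1"
    using frac_ge_0[of x] unfolding i_def by (auto simp: of_nat_nat)
  have "frac x * N < 1 * real N" using assms frac_lt_1[of x] by (intro mult_strict_right_mono) auto
  then have "real i < real N" using i(1) by linarith
  moreover have "i / N \<le> frac x" "frac x \<le> i / N + 1 / N"
    using i assms by (simp_all add: field_simps)
  ultimately show ?thesis by (intro exI[of _ i]) (auto simp: frac_def)
qed

text \<open>The plane consists of countably many unit squares; cutting the \<open>m\<close>-th one
  finely enough makes its share of the sum at most \<open>e / 2 ^ (m + 1)\<close>.\<close>

lemma hausdorff_measure_plane_eq_0:
  fixes E :: "(real \<times> real) set"
  assumes s: "s > 2"
  shows "hausdorff_measure s E = 0"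
proof -
  have le: "hausdorff_content s \<delta> E \<le> ennreal e" if \<delta>: "\<delta> > 0" and e: "e > 0" for \<delta> e :: real
  proof -
    have "\<exists>N::nat. N > 0 \<and> 2 / N \<le> \<delta> \<and> real (N * N) * (2 / N) powr s \<le> e * (1 / 2) ^ Suc m" for m
      by (rule ex_grid_refinement[OF s \<delta>]) (use e in auto)
    then obtain N :: "nat \<Rightarrow> nat" where N: "\<And>m. N m > 0" "\<And>m. 2 / real (N m) \<le> \<delta>"
      "\<And>m. real (N m * N m) * (2 / N m) powr s \<le> e * (1 / 2) ^ Suc m"
      by metis
    define B where "B k i n = {of_int (int_decode k) + real i / real n ..
        of_int (int_decode k) + real i / real n + 1 / real n}" for k i n :: nat
    \<comment> \<open>\<open>m\<close> encodes the integer corner of a unit square, and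
      \<open>l\<close> its small square by quotient and remainder modulo \<open>N m\<close>. Further
      \<open>l\<close> give empty sets, which add 0 to the sum.\<close>
    define W :: "nat \<times> nat \<Rightarrow> (real \<times> real) set" where
      "W = (\<lambda>(m, l). if l < N m * N m then B (fst (prod_decode m)) (l div N m) (N m)
                 \<times> B (snd (prod_decode m)) (l mod N m) (N m) else {})"
    define U where "U i = W (prod_decode i)" for i
    have dW: "dist x y \<le> 2 / N m" if xy: "x \<in> W (m, l)" "y \<in> W (m, l)" for m l x y
    proof -
      have B: "dist a b \<le> 1 / n" if "a \<in> B k i n" "b \<in> B k i n" for a b k i n
        using that by (auto simp: B_def dist_real_def)
      have "dist (fst x) (fst y) \<le> 1 / N m" "dist (snd x) (snd y) \<le> 1 / N m"
        using xy by (auto simp: W_def split: if_splits intro!: B)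
      moreover have "dist x y \<le> dist (fst x) (fst y) + dist (snd x) (snd y)"
        unfolding dist_prod_def by (rule sqrt_sum_squares_le_sum) auto
      ultimately show ?thesis by simp
    qed
    have bW: "bounded (W p)" and diamW: "diameter (W p) \<le> 2 / N (fst p)" for p
    proof -
      obtain m l where p: "p = (m, l)" by (cases p)
      show "bounded (W p)" unfolding p bounded_any_center
        using dW[of _ m l] unfolding bounded_def by (cases "W (m, l) = {}") blast+
      show "diameter (W p) \<le> 2 / N (fst p)" unfolding p
        using dW[of _ m l] by (intro diameter_le) (auto simp: dist_norm)
    qed
    have "E \<subseteq> (\<Union>i. U i)"
    proof
      fix z :: "real \<times> real" assume "z \<in> E"
      define m where "m = prod_encode (int_encode \<lfloor>fst z\<rfloor>, int_encode \<lfloor>snd z\<rfloor>)"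
      obtain i j where i: "i < N m" "fst z \<in> B (int_encode \<lfloor>fst z\<rfloor>) i (N m)"
        and j: "j < N m" "snd z \<in> B (int_encode \<lfloor>snd z\<rfloor>) j (N m)"
        using unit_interval_grid[OF N(1)[of m], of "fst z"] unit_interval_grid[OF N(1)[of m], of "snd z"]
        unfolding B_def by auto
      define l where "l = i * N m + j"
      have l: "l div N m = i" "l mod N m = j" using j by (auto simp: l_def)
      have "i * N m + j < i * N m + N m" using j by simp
      also have "\<dots> = (i + 1) * N m" by simp
      also have "\<dots> \<le> N m * N m" using i by (intro mult_le_mono) auto
      finally have "l < N m * N m" by (simp add: l_def)
      then have "z \<in> W (m, l)" using i j l by (simp add: W_def m_def mem_Times_iff)
      then have "z \<in> U (prod_encode (m, l))" by (simp add: U_def)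
      then show "z \<in> (\<Union>i. U i)" by blast
    qed
    moreover have "diameter (U i) \<le> \<delta>" for i
      unfolding U_def by (rule order_trans[OF diamW N(2)])
    ultimately have "hausdorff_content s \<delta> E \<le> (\<Sum>i. ennreal (diameter (U i) powr s))"
      unfolding hausdorff_content_def
      using bW by (intro INF_lower) (auto simp: U_def)
    also have "\<dots> = (\<Sum>m. \<Sum>l. ennreal (diameter (W (m, l)) powr s))"
      unfolding U_def by (rule suminf_ennreal_2dimen[of _ "\<lambda>p. ennreal (diameter (W p) powr s)"]) simp
    also have "\<dots> \<le> (\<Sum>m. ennreal (e * (1 / 2) ^ Suc m))"
    proof (intro suminf_le summableI)
      fix m
      have "(\<Sum>l. ennreal (diameter (W (m, l)) powr s)) = (\<Sum>l<N m * N m. ennreal (diameter (W (m, l)) powr s))"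
        using s by (intro suminf_finite) (auto simp: W_def)
      also have "\<dots> \<le> (\<Sum>l<N m * N m. ennreal ((2 / N m) powr s))"
        using diamW[of "(m, _)"] s
        by (intro sum_mono ennreal_leI powr_mono2) (auto simp: diameter_ge_0 bW)
      also have "\<dots> = ennreal (real (N m * N m) * (2 / N m) powr s)"
        by (simp add: ennreal_mult ennreal_of_nat_eq_real_of_nat)
      also have "\<dots> \<le> ennreal (e * (1 / 2) ^ Suc m)" using N(3) by (rule ennreal_leI)
      finally show "(\<Sum>l. ennreal (diameter (W (m, l)) powr s)) \<le> ennreal (e * (1 / 2) ^ Suc m)" .
    qed
    also have "\<dots> = ennreal e"
    proof -
      have "(\<lambda>m. e * (1 / 2) ^ Suc m) sums (e * 1)" by (intro sums_mult power_half_series)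
      then show ?thesis using e by (subst suminf_ennreal_eq[where x = e]) auto
    qed
    finally show ?thesis .
  qed
  have "hausdorff_content s \<delta> E = 0" if "\<delta> > 0" for \<delta>
  proof -
    have "hausdorff_content s \<delta> E \<le> 0"
      by (rule ennreal_le_epsilon) (simp add: le[OF that])
    then show ?thesis by simp
  qed
  then have "hausdorff_measure s E \<le> 0" unfolding hausdorff_measure_def by (intro SUP_least) simp
  then show ?thesis by simp
qed

section \<open>The Hausdorff dimension\<close>

text \<open>A \<open>q\<close> of stage \<open>n\<close> has \<open>ln q \<ge> 4 ^ n * ln 2\<close>,
  so the factor \<open>16 ^ n\<close> in \<open>bad n\<close> is paid for by the squared logarithm,
  up to the constant \<open>(ln 2)\<^sup>2\<close>.\<close>

lemma liminf_pos_if_not_bad: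
  assumes "\<And>n. n \<ge> k \<Longrightarrow> (x, y) \<notin> bad n"
  shows "0 < liminf (\<lambda>q::nat. ereal (real q * (ln (real q))\<^sup>2 * nint_dist (real q * x) * nint_dist (real q * y)))"
proof -
  have "(ln 2)\<^sup>2 / 2 ^ 16 \<le> real q * (ln (real q))\<^sup>2 * nint_dist (real q * x) * nint_dist (real q * y)"
    if q: "2 ^ 4 ^ k \<le> q" for q :: nat
  proof -
    \<comment> \<open>The stage of \<open>q\<close> is the predecessor of the first \<open>m\<close>
      with \<open>q < 2 ^ 4 ^ m\<close>.\<close>
    define m where "m = (LEAST m. q < 2 ^ 4 ^ m)"
    have "q < 4 ^ q" by (rule power_gt_expt) simp
    also have "(4::nat) ^ q < 2 ^ 4 ^ q" by (rule power_gt_expt) simp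
    finally have "q < 2 ^ 4 ^ q" .
    then have m: "q < 2 ^ 4 ^ m" unfolding m_def by (rule LeastI)
    have km: "k < m"
    proof (rule ccontr)
      assume "\<not> k < m"
      then have "(2::nat) ^ 4 ^ m \<le> 2 ^ 4 ^ k" by (intro power_increasing) auto
      then show False using m q by linarith
    qed
    define n where "n = m - 1"
    have mn: "m = n + 1" and kn: "k \<le> n" using km by (auto simp: n_def)
    have qn: "2 ^ 4 ^ n \<le> q" using not_less_Least[of n "\<lambda>m. q < 2 ^ 4 ^ m"] mn unfolding m_def by simp
    have q0: "q > 0" using qn by (meson less_le_trans zero_less_numeral zero_less_power)
    have nb: "1 / (2 ^ 16 * real q * 16 ^ n) \<le> nint_dist (q * x) * nint_dist (q * y)"
      using assms[OF kn] qn m unfolding mn bad_def by force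
    have "real (2 ^ 4 ^ n) \<le> real q" using qn by (rule of_nat_mono)
    then have "ln (2 ^ 4 ^ n) \<le> ln (real q)" using q0 by (subst ln_le_cancel_iff) auto
    then have "4 ^ n * ln 2 \<le> ln (real q)" by (simp add: ln_realpow)
    then have "(4 ^ n * ln 2)\<^sup>2 \<le> (ln (real q))\<^sup>2" by (intro power_mono) auto
    moreover have "((4::real) ^ n)\<^sup>2 = 16 ^ n"
      by (simp add: power2_eq_square flip: power_mult_distrib)
    ultimately have L: "16 ^ n * (ln 2)\<^sup>2 \<le> (ln (real q))\<^sup>2" by (simp add: power_mult_distrib)
    have "(ln 2)\<^sup>2 / 2 ^ 16 = real q * (16 ^ n * (ln 2)\<^sup>2) * (1 / (2 ^ 16 * real q * 16 ^ n))"
      using q0 by simp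
    also have "\<dots> \<le> real q * (ln (real q))\<^sup>2 * (nint_dist (q * x) * nint_dist (q * y))"
      using L nb by (intro mult_mono mult_nonneg_nonneg) auto
    finally show ?thesis by (simp add: mult.assoc)
  qed
  then have "eventually (\<lambda>q::nat. ereal ((ln 2)\<^sup>2 / 2 ^ 16)
      \<le> ereal (real q * (ln (real q))\<^sup>2 * nint_dist (real q * x) * nint_dist (real q * y))) sequentially"
    unfolding eventually_sequentially ereal_less_eq by blast
  then have "ereal ((ln 2)\<^sup>2 / 2 ^ 16)
      \<le> liminf (\<lambda>q::nat. ereal (real q * (ln (real q))\<^sup>2 * nint_dist (real q * x) * nint_dist (real q * y)))"
    by (rule Liminf_bounded)
  moreover have "0 < ereal ((ln 2)\<^sup>2 / 2 ^ 16)" by simp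
  ultimately show ?thesis by (rule less_le_trans[rotated])
qed

lemma side_le_half: "side n \<le> 1 / 2"
proof -
  have "(2::real) ^ 1 \<le> 2 ^ level n" by (intro power_increasing) (auto simp: level_def)
  then show ?thesis by (simp add: side_def field_simps)
qed

text \<open>Measure 0 would yield a cover of \<open>E\<close> with small sum, and the construction
  finds a point of \<open>E\<close> outside it.\<close>

lemma hausdorff_measure_not_bad_neq_0:
  fixes E :: "(real \<times> real) set"
  assumes E: "\<And>z k. (\<And>n. n \<ge> k \<Longrightarrow> z \<notin> bad n) \<Longrightarrow> z \<in> E" and s: "s < 2"
  shows "hausdorff_measure s E \<noteq> 0"
proof
  assume H: "hausdorff_measure s E = 0"
  \<comment> \<open>An exponent of at least 1 is positive and satisfies
    \<open>x powr t \<le> x\<close> for \<open>x\<close> in the unit interval; raising it only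
    lowers powers of the diameters, which are below 1.\<close>
  define t where "t = max s 1"
  have t: "1 \<le> t" "s \<le> t" "t < 2" using s by (auto simp: t_def)
  obtain n1 :: nat where n1: "1 / (2 - t) < real n1" using reals_Archimedean2 by blast
  define n0 where "n0 = max n1 1"
  have n0: "n0 \<ge> 1" by (simp add: n0_def)
  have "1 < real n1 * (2 - t)" using n1 t by (simp add: field_simps)
  also have "\<dots> \<le> real n0 * (2 - t)" using t by (intro mult_right_mono) (auto simp: n0_def)
  finally have nt: "1 \<le> real n0 * (2 - t)" by simp
  define \<sigma> where "\<sigma> = side (n0 + 1)"
  have \<sigma>: "0 < \<sigma>" "\<sigma> \<le> 1 / 2" unfolding \<sigma>_def by (rule side_pos, rule side_le_half)
  have "hausdorff_content s (\<sigma> / 2) E \<le> hausdorff_measure s E"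
    unfolding hausdorff_measure_def using \<sigma> by (intro SUP_upper) auto
  then have "hausdorff_content s (\<sigma> / 2) E = 0" using H by simp
  moreover have "0 < ennreal (1 / 2)" by (rule ennreal_less_zero_iff[THEN iffD2]) simp
  ultimately have "hausdorff_content s (\<sigma> / 2) E < ennreal (1 / 2)" by (simp only:)
  then obtain U :: "nat \<Rightarrow> (real \<times> real) set" where U: "\<And>i. bounded (U i)" "\<And>i. diameter (U i) \<le> \<sigma> / 2"
    and cover: "E \<subseteq> (\<Union>i. U i)" and sum: "(\<Sum>i. ennreal (diameter (U i) powr s)) < ennreal (1 / 2)"
    unfolding hausdorff_content_def INF_less_iff by blast
  \<comment> \<open>Diameters may vanish, but the construction needs positive radii. The geometric
    floor adds at most 1/2 to the sum, the other half being left for the diameters.\<close>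
  define r where "r i = max (diameter (U i)) (\<sigma> * (1 / 2) ^ Suc i)" for i
  have dsm: "summable (\<lambda>i. diameter (U i) powr s)"
    using sum by (intro summable_suminf_not_top) auto
  have dle: "(\<Sum>i. diameter (U i) powr s) \<le> 1 / 2"
  proof -
    have "ennreal (\<Sum>i. diameter (U i) powr s) < ennreal (1 / 2)"
      using sum dsm by (subst suminf_ennreal2[symmetric]) auto
    moreover have "0 \<le> (\<Sum>i. diameter (U i) powr s)" by (intro suminf_nonneg dsm) simp
    ultimately have "(\<Sum>i. diameter (U i) powr s) < 1 / 2" by (simp only: ennreal_less_iff)
    then show ?thesis by simp
  qed
  have geo: "(\<lambda>i. 1 / 2 * (1 / 2) ^ Suc i) sums (1 / 2 * 1 :: real)" by (intro sums_mult power_half_series)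
  have rle: "r i powr t \<le> diameter (U i) powr s + 1 / 2 * (1 / 2) ^ Suc i" for i
  proof -
    have "(1 / 2 :: real) ^ Suc i \<le> 1" by (rule power_le_one) auto
    then have "\<sigma> * (1 / 2) ^ Suc i \<le> 1 / 2 * 1" using \<sigma> by (intro mult_mono) auto
    then have "(\<sigma> * (1 / 2) ^ Suc i) powr t \<le> (\<sigma> * (1 / 2) ^ Suc i) powr 1"
      using t \<sigma> by (intro powr_mono') auto
    also have "\<dots> = \<sigma> * (1 / 2) ^ Suc i" using \<sigma> by simp
    also have "\<dots> \<le> 1 / 2 * (1 / 2) ^ Suc i" using \<sigma> by (intro mult_right_mono) auto
    finally have 1: "(\<sigma> * (1 / 2) ^ Suc i) powr t \<le> 1 / 2 * (1 / 2) ^ Suc i" .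
    have 2: "diameter (U i) powr t \<le> diameter (U i) powr s"
      using t diameter_ge_0[OF U(1)[of i]] U(2)[of i] \<sigma> by (intro powr_mono') auto
    have "0 \<le> diameter (U i) powr s" "(0::real) \<le> 1 / 2 * (1 / 2) ^ Suc i" by auto
    then show ?thesis using 1 2 unfolding r_def max_def by (simp only: split: if_split) linarith
  qed
  have rsm: "summable (\<lambda>i. r i powr t)"
    by (rule summable_comparison_test'[OF summable_add[OF dsm sums_summable[OF geo]], of 0]) (use rle in auto)
  have "(\<Sum>i. r i powr t) \<le> (\<Sum>i. diameter (U i) powr s + 1 / 2 * (1 / 2) ^ Suc i)"
    by (rule suminf_le[OF rle rsm summable_add[OF dsm sums_summable[OF geo]]])
  also have "\<dots> = (\<Sum>i. diameter (U i) powr s) + 1 / 2"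
    using suminf_add[OF dsm sums_summable[OF geo]] sums_unique[OF geo] by simp
  finally have rsum: "(\<Sum>i. r i powr t) \<le> 1" using dle by linarith
  have r0: "0 < r i" for i using \<sigma> by (simp add: r_def less_max_iff_disj)
  have r1: "r i < side (n0 + 1)" for i
  proof -
    have "(1 / 2 :: real) ^ Suc i \<le> (1 / 2) ^ 1" by (intro power_decreasing) auto
    then have "\<sigma> * (1 / 2) ^ Suc i \<le> \<sigma> * (1 / 2)" using \<sigma> by (intro mult_left_mono) auto
    then show ?thesis using U(2)[of i] \<sigma> unfolding r_def \<sigma>_def[symmetric] by auto
  qed
  have rU: "dist x y \<le> r i" if "x \<in> U i" "y \<in> U i" for i x y
    using diameter_bounded_bound[OF U(1) that] by (simp add: r_def)
  have t0: "0 < t" using t(1) by simp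
  obtain z where z: "\<forall>i. z \<notin> U i" "\<forall>n\<ge>n0 + 2. z \<notin> bad n"
    using ex_point_avoiding_cover_and_bad[OF n0 t0 t(3) nt r0 r1 rU rsm rsum] by blast
  then have "z \<in> E" using E by blast
  then show False using z(1) cover by blast
qed

text \<open>The admissible exponents include everything above 2 and nothing below 2, so the infimum
  is 2 whatever happens at 2 itself.\<close>

theorem theorem2:
  shows "hausdorff_dim
           {(\<alpha>::real, \<beta>::real).
              liminf (\<lambda>q::nat. ereal (real q * (ln (real q))\<^sup>2
                                      * nint_dist (real q * \<alpha>) * nint_dist (real q * \<beta>))) > 0}
         = 2"
    (is "hausdorff_dim ?E = 2")
proof -
  let ?S = "{s. 0 \<le> s \<and> hausdorff_measure s ?E = 0}"
  have "z \<in> ?E" if "\<And>n. n \<ge> k \<Longrightarrow> z \<notin> bad n" for z k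
    using liminf_pos_if_not_bad[of k "fst z" "snd z"] that by (simp add: case_prod_beta)
  then have lower: "2 \<le> s" if "s \<in> ?S" for s
    using that hausdorff_measure_not_bad_neq_0[of ?E s] by force
  have upper: "s \<in> ?S" if "s > 2" for s
    using that hausdorff_measure_plane_eq_0[of s ?E] by simp
  have bdd: "bdd_below ?S" using lower by (rule bdd_belowI)
  have "Inf ?S \<le> 2"
  proof (rule field_le_epsilon)
    fix e :: real assume "e > 0"
    then show "Inf ?S \<le> 2 + e" by (intro cInf_lower[OF upper bdd]) simp
  qed
  moreover have "2 \<le> Inf ?S"
  proof (rule cInf_greatest[OF _ lower])
    have "3 \<in> ?S" by (rule upper) simp
    then show "?S \<noteq> {}" by blast
  qed
  ultimately show ?thesis unfolding hausdorff_dim_def by (rule antisym)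
qed

end
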